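(* Let $\alpha$ be a $2$-dimensional complex representation of $\Gamma=\mathrm{SL}_2(\mathbf{Z})$. Then $\mathrm{Sym}^3\alpha$ is irreducible if and only if $\alpha$ is irreducible and one of the following holds: (1) $\alpha\cong\nu\otimes\chi$ for some $1$-dimensional character $\chi$ of $\Gamma$, where $\nu\colon\Gamma\hookrightarrow\mathrm{GL}_2(\mathbf{C})$ is the standard inclusion; (2) $\alpha$ and $\mathrm{Sym}^3\alpha$ are both $T$-regular.
   Context: $T=\begin{pmatrix}1&1\\0&1\end{pmatrix}$. A representation $\rho$ of $\Gamma$ is $T$-regular if the eigenvalues of $\rho(T)$ are pairwise distinct. $\mathrm{Sym}^3\alpha$ is the $4$-dimensional representation on the third symmetric power of the underlying space of $\alpha$. *)

theory Defs
  imports "HOL-Analysis.Analysis" "HOL-Algebra.Group"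
begin

definition SL2Z :: "(int^2^2) monoid"
  where "SL2Z = \<lparr>carrier = {g. det g = 1}, mult = (**), one = mat 1\<rparr>"

definition T_mat :: "int^2^2"
  where "T_mat = vector [vector [1, 1], vector [0, 1]]"

definition GL_complex :: "(complex^'n^'n) monoid"
  where "GL_complex = \<lparr>carrier = {A. invertible A}, mult = (**), one = mat 1\<rparr>"

definition mult_group_complex :: "complex monoid"
  where "mult_group_complex = \<lparr>carrier = - {0}, mult = (*), one = 1\<rparr>"

text \<open>Finite-dimensional complex representations are taken on coordinate spaces. Only the values
  on the carrier of \<^const>\<open>SL2Z\<close> matter. Preservation of the identity follows, since domain and
  codomain are groups.\<close>

definition representation :: "(int^2^2 \<Rightarrow> complex^'n^'n) \<Rightarrow> bool"
  where "representation \<rho> \<longleftrightarrow> \<rho> \<in> hom SL2Z GL_complex"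

definition character :: "(int^2^2 \<Rightarrow> complex) \<Rightarrow> bool"
  where "character \<psi> \<longleftrightarrow> \<psi> \<in> hom SL2Z mult_group_complex"

text \<open>The ambient space is never zero, because index types are nonempty.\<close>

definition irreducible_rep :: "(int^2^2 \<Rightarrow> complex^'n^'n) \<Rightarrow> bool"
  where "irreducible_rep \<rho> \<longleftrightarrow>
    (\<forall>W. vec.subspace W \<and> (\<forall>g\<in>carrier SL2Z. \<forall>w\<in>W. \<rho> g *v w \<in> W) \<longrightarrow> W = {0} \<or> W = UNIV)"

definition iso_rep ::
    "(int^2^2 \<Rightarrow> complex^'n^'n) \<Rightarrow> (int^2^2 \<Rightarrow> complex^'n^'n) \<Rightarrow> bool"
  where "iso_rep \<rho> \<sigma> \<longleftrightarrow>
    (\<exists>P. invertible P \<and> (\<forall>g\<in>carrier SL2Z. P ** \<rho> g = \<sigma> g ** P))"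

definition standard_rep :: "int^2^2 \<Rightarrow> complex^2^2"
  where "standard_rep g = map_matrix of_int g"

definition twist ::
    "(int^2^2 \<Rightarrow> complex^'n^'n) \<Rightarrow> (int^2^2 \<Rightarrow> complex) \<Rightarrow> int^2^2 \<Rightarrow> complex^'n^'n"
  where "twist \<rho> \<psi> g = (\<chi> i j. \<psi> g * \<rho> g $ i $ j)"

definition charpoly :: "complex^'n^'n \<Rightarrow> complex poly"
  where "charpoly A = det (mat [:0, 1:] - map_matrix (\<lambda>a. [:a:]) A)"

text \<open>Eigenvalues are listed with algebraic multiplicity.\<close>

definition eigenvalues :: "complex^'n^'n \<Rightarrow> complex multiset"
  where "eigenvalues A = proots (charpoly A)"

definition T_regular :: "(int^2^2 \<Rightarrow> complex^'n^'n) \<Rightarrow> bool"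
  where "T_regular \<rho> \<longleftrightarrow> (\<forall>l\<in>#eigenvalues (\<rho> T_mat). count (eigenvalues (\<rho> T_mat)) l = 1)"

text \<open>The third symmetric power of \<open>\<complex>\<^sup>2\<close> is the space of homogeneous polynomials of degree 3 in
  the basis vectors \<open>e\<^sub>1, e\<^sub>2\<close>. Such a polynomial is stored in dehomogenised form (\<open>e\<^sub>1 = 1\<close>,
  \<open>e\<^sub>2\<close> the polynomial variable), and coordinate \<open>i\<close> refers to the monomial
  \<open>e\<^sub>1\<^sup>3\<^sup>-\<^sup>d e\<^sub>2\<^sup>d\<close> with \<open>d = sym3_deg i\<close>.\<close>

definition sym3_deg :: "4 \<Rightarrow> nat"
  where "sym3_deg i = (if i = 1 then 0 else if i = 2 then 1 else if i = 3 then 2 else 3)"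

definition linear_form :: "complex^2 \<Rightarrow> complex poly"
  where "linear_form v = [:v$1, v$2:]"

definition sym3_prod :: "complex^2 \<Rightarrow> complex^2 \<Rightarrow> complex^2 \<Rightarrow> complex^4"
  where "sym3_prod u v w =
    (\<chi> i. coeff (linear_form u * linear_form v * linear_form w) (sym3_deg i))"

text \<open>Column \<open>j\<close> of \<open>Sym3_mat A\<close> is the image \<open>(A e\<^sub>1)\<^sup>3\<^sup>-\<^sup>d (A e\<^sub>2)\<^sup>d\<close> of the monomial indexed
  by \<open>j\<close>; the lemma \<open>Sym3_mat_prod\<close> below characterises the map without coordinates.\<close>

definition Sym3_mat :: "complex^2^2 \<Rightarrow> complex^4^4"
  where "Sym3_mat A = (\<chi> i j.
    coeff (linear_form (column 1 A) ^ (3 - sym3_deg j) * linear_form (column 2 A) ^ sym3_deg j)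
      (sym3_deg i))"

definition Sym3 :: "(int^2^2 \<Rightarrow> complex^2^2) \<Rightarrow> int^2^2 \<Rightarrow> complex^4^4"
  where "Sym3 \<rho> g = Sym3_mat (\<rho> g)"

lemma sym3_deg_simps [simp]:
  "sym3_deg 1 = 0" "sym3_deg 2 = 1" "sym3_deg 3 = 2" "sym3_deg 4 = 3"
  by (simp_all add: sym3_deg_def)

lemma Sym3_mat_prod:
  "Sym3_mat A *v sym3_prod u v w = sym3_prod (A *v u) (A *v v) (A *v w)"
  by (simp add: vec_eq_iff forall_4 sum_4 sum_2 matrix_vector_mult_def Sym3_mat_def
      sym3_prod_def linear_form_def column_def numeral_eq_Suc algebra_simps)

lemma Sym3_mat_mult: "Sym3_mat (A ** B) = Sym3_mat A ** Sym3_mat B"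
  by (simp add: vec_eq_iff forall_4 sum_4 sum_2 matrix_matrix_mult_def Sym3_mat_def
      linear_form_def column_def numeral_eq_Suc algebra_simps)

lemma Sym3_mat_one: "Sym3_mat (mat 1) = mat 1"
  by (simp add: vec_eq_iff forall_4 mat_def Sym3_mat_def
      linear_form_def column_def numeral_eq_Suc)

lemma representation_Sym3:
  assumes "representation \<rho>"
  shows "representation (Sym3 \<rho>)"
proof -
  have "invertible (Sym3_mat A)" if "invertible A" for A
    using that unfolding invertible_def by (metis Sym3_mat_mult Sym3_mat_one)
  with assms show ?thesis
    by (auto simp: representation_def hom_def Pi_iff SL2Z_def GL_complex_def Sym3_def Sym3_mat_mult)
qed

end

theory Submission
  imports Defs
begin

text \<open>\<open>\<Gamma>\<close> is generated by \<open>S\<close> and \<open>T\<close>, with \<open>S\<^sup>2 = (S T)\<^sup>3\<close> central. An invariant line of \<open>\<alpha>\<close> spanned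
  by \<open>v\<close> yields the invariant line of \<open>v\<^sup>3\<close>, so let \<open>\<alpha>\<close> be irreducible and choose a
  basis \<open>e\<^sub>1, e\<^sub>2\<close> in which \<open>\<alpha>(T)\<close> is triangular with diagonal \<open>x, y\<close>.

  If \<open>x = y\<close>, then \<open>\<alpha>(T)\<close> is a nontrivial Jordan block, and the relations force \<open>\<alpha>\<close> to be a twist
  of the standard representation. Its symmetric cube is irreducible: \<open>T\<close> acts by a single Jordan
  block up to a scalar, so every nonzero invariant subspace contains \<open>e\<^sub>1\<^sup>3\<close>, which generates.

  If \<open>x \<noteq> y\<close>, then the relations give \<open>\<alpha>(S) = (a, b; c, - a)\<close> with \<open>a, b, c\<close> nonzero and
  \<open>a\<^sup>2 (x - y)\<^sup>2 = - x y (a\<^sup>2 + b c)\<close>. When \<open>Sym\<^sup>3 \<alpha>\<close> is \<open>T\<close>-regular, an invariant subspace is spanned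
  by monomials, and \<open>S\<close> links each of them to \<open>e\<^sub>1\<^sup>3\<close> and back. It fails to be \<open>T\<close>-regular
  only if \<open>y / x\<close> is \<open>- 1\<close> or a primitive cube root of unity (dihedral and tetrahedral projective
  image), and then an invariant line, respectively plane, can be written down.\<close>

subsection \<open>Generators and relations\<close>

text \<open>Naming the four entries lets the simplifier turn matrix equations into polynomial
  equations between entries.\<close>

definition mat2 :: "'a::zero \<Rightarrow> 'a \<Rightarrow> 'a \<Rightarrow> 'a \<Rightarrow> 'a^2^2"
  where "mat2 a b c d = vector [vector [a, b], vector [c, d]]"

lemma mat2_nth [simp]:
  "mat2 a b c d $ 1 $ 1 = a" "mat2 a b c d $ 1 $ 2 = b"
  "mat2 a b c d $ 2 $ 1 = c" "mat2 a b c d $ 2 $ 2 = d"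
  by (simp_all add: mat2_def)

lemma mat2_eta: "A = mat2 (A $ 1 $ 1) (A $ 1 $ 2) (A $ 2 $ 1) (A $ 2 $ 2)"
  by (simp add: vec_eq_iff forall_2)

lemma mat2_cases: obtains a b c d where "A = mat2 a b c d"
  using mat2_eta by blast

lemma mat2_eq_iff [simp]:
  "mat2 a b c d = mat2 a' b' c' d' \<longleftrightarrow> a = a' \<and> b = b' \<and> c = c' \<and> d = d'"
  by (auto simp: vec_eq_iff forall_2)

lemma mat2_mult [simp]:
  fixes a :: "'a::comm_ring_1"
  shows "mat2 a b c d ** mat2 a' b' c' d' =
    mat2 (a * a' + b * c') (a * b' + b * d') (c * a' + d * c') (c * b' + d * d')"
  by (simp add: vec_eq_iff forall_2 matrix_matrix_mult_def sum_2)

lemma mat2_mult_vec [simp]: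
  fixes a :: "'a::comm_ring_1"
  shows "mat2 a b c d *v vector [p, q] = vector [a * p + b * q, c * p + d * q]"
  by (simp add: vec_eq_iff forall_2 matrix_vector_mult_def sum_2)

lemma det_mat2 [simp]:
  fixes a :: "'a::comm_ring_1"
  shows "det (mat2 a b c d) = a * d - b * c"
  by (simp add: det_2)

lemma mat_eq_mat2: "(mat k :: 'a::zero^2^2) = mat2 k 0 0 k"
  by (simp add: vec_eq_iff forall_2 mat_def)

lemma T_mat_eq: "T_mat = mat2 1 1 0 1"
  by (simp add: T_mat_def mat2_def)

definition S_mat :: "int^2^2"
  where "S_mat = mat2 0 (- 1) 1 0"

lemma S_in_SL2Z [simp]: "S_mat \<in> carrier SL2Z"
  and T_in_SL2Z [simp]: "T_mat \<in> carrier SL2Z"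
  by (simp_all add: SL2Z_def S_mat_def T_mat_eq)

lemma SL2Z_mult_closed: "g \<in> carrier SL2Z \<Longrightarrow> h \<in> carrier SL2Z \<Longrightarrow> g ** h \<in> carrier SL2Z"
  by (simp add: SL2Z_def det_mul)

text \<open>Euclidean algorithm on the bottom row. Closure under products alone suffices, because
  the inverses of \<open>S_mat\<close> and \<open>T_mat\<close> are positive words in the two
  generators.\<close>

lemma SL2Z_induct [consumes 1, case_names S T mult]:
  assumes "g \<in> carrier SL2Z"
    and S: "Q S_mat" and T: "Q T_mat"
    and mult: "\<And>g h. g \<in> carrier SL2Z \<Longrightarrow> h \<in> carrier SL2Z \<Longrightarrow> Q g \<Longrightarrow> Q h \<Longrightarrow> Q (g ** h)"
  shows "Q g"
proof -
  define R where "R g \<longleftrightarrow> g \<in> carrier SL2Z \<and> Q g" for g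
  have R_mult: "R (g ** h)" if "R g" "R h" for g h
    using that mult by (simp add: R_def SL2Z_mult_closed)
  have RS: "R (mat2 0 (- 1) 1 0)" and RT: "R (mat2 1 1 0 1)"
    using S T by (simp_all add: R_def flip: S_mat_def T_mat_eq)
  have R_neg: "R (mat2 (- 1) 0 0 (- 1))" using R_mult [OF RS RS] by simp
  have R_one: "R (mat2 1 0 0 1)" using R_mult [OF R_neg R_neg] by simp
  have RS': "R (mat2 0 1 (- 1) 0)" using R_mult [OF RS R_neg] by simp
  \<comment> \<open>This is \<open>(S T)^2\<close>; multiplied by \<open>S^-1 = S^3\<close> it gives
    \<open>T^-1\<close>, as \<open>(S T)^3 = S^2\<close>.\<close>
  have "R (mat2 (- 1) (- 1) 1 0)"
    using R_mult [OF R_mult [OF RS RT] R_mult [OF RS RT]] by simp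
  then have RT': "R (mat2 1 (- 1) 0 1)"
    using R_mult [OF _ RS', of "mat2 (- 1) (- 1) 1 0"] by simp
  have R_nat: "R (mat2 1 (int n) 0 1) \<and> R (mat2 1 (- int n) 0 1)" for n
  proof (induction n)
    case (Suc n)
    then show ?case using R_mult [OF RT, of "mat2 1 (int n) 0 1"] R_mult [OF RT', of "mat2 1 (- int n) 0 1"]
      by (simp add: algebra_simps)
  qed (simp add: R_one)
  have R_int: "R (mat2 1 n 0 1)" for n
    using R_nat [of "nat \<bar>n\<bar>"] by (cases "n \<ge> 0") auto
  have "R (mat2 a b c d)" if "a * d - b * c = 1" for a b c d :: int
    using that
  proof (induction "nat \<bar>c\<bar>" arbitrary: a b c d rule: less_induct)
    case less
    show ?case
    proof (cases "c = 0")
      case True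
      with less.prems have "a = 1 \<and> d = 1 \<or> a = - 1 \<and> d = - 1"
        by (simp add: zmult_eq_1_iff)
      with True R_int [of b] R_mult [OF R_neg R_int [of "- b"]] show ?thesis by auto
    next
      case False
      \<comment> \<open>The matrix factors as
        \<open>mat2 (b - a * n) (- a) (d - c * n) (- c)\<close> times \<open>S^-1 T^n\<close>, and
        the lower left entry of the first factor is the remainder of \<open>d\<close> modulo
        \<open>c\<close>.\<close>
      define n where "n = d div c"
      have "\<bar>d - c * n\<bar> < \<bar>c\<bar>"
        using False by (simp add: n_def minus_mult_div_eq_mod abs_mod_less)
      then have "R (mat2 (b - a * n) (- a) (d - c * n) (- c))"
        using less.prems by (intro less.hyps) (auto simp: algebra_simps)
      from R_mult [OF R_mult [OF this RS'] R_int [of n]] show ?thesis by simp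
    qed
  qed
  then have "R (mat2 (g$1$1) (g$1$2) (g$2$1) (g$2$2))"
    using assms(1) by (simp add: SL2Z_def det_2)
  then show ?thesis by (simp add: R_def flip: mat2_eta)
qed

lemma representation_mult:
  assumes "representation \<rho>" "g \<in> carrier SL2Z" "h \<in> carrier SL2Z"
  shows "\<rho> (g ** h) = \<rho> g ** \<rho> h"
  using assms by (simp add: representation_def hom_def SL2Z_def GL_complex_def)

lemma representation_invertible:
  assumes "representation \<rho>" "g \<in> carrier SL2Z"
  shows "invertible (\<rho> g)"
  using assms by (auto simp: representation_def hom_def SL2Z_def GL_complex_def)

text \<open>Read off entry by entry, these two relations are what constrains the matrix of
  \<open>S_mat\<close> once that of \<open>T_mat\<close> is in normal form.\<close>

lemma representation_rel:
  assumes "representation \<rho>"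
  shows "\<rho> S_mat ** \<rho> S_mat =
      \<rho> S_mat ** \<rho> T_mat ** (\<rho> S_mat ** \<rho> T_mat) ** (\<rho> S_mat ** \<rho> T_mat)" (is ?a)
    and "\<rho> S_mat ** \<rho> S_mat ** \<rho> T_mat = \<rho> T_mat ** (\<rho> S_mat ** \<rho> S_mat)" (is ?b)
proof -
  have "S_mat ** S_mat = S_mat ** T_mat ** (S_mat ** T_mat) ** (S_mat ** T_mat)"
    by (simp add: S_mat_def T_mat_eq)
  then have "\<rho> (S_mat ** S_mat) = \<rho> (S_mat ** T_mat ** (S_mat ** T_mat) ** (S_mat ** T_mat))"
    by simp
  then show ?a by (simp add: representation_mult [OF assms] SL2Z_mult_closed)
  have "S_mat ** S_mat ** T_mat = T_mat ** (S_mat ** S_mat)"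
    by (simp add: S_mat_def T_mat_eq)
  then have "\<rho> (S_mat ** S_mat ** T_mat) = \<rho> (T_mat ** (S_mat ** S_mat))"
    by simp
  then show ?b by (simp add: representation_mult [OF assms] SL2Z_mult_closed)
qed

lemma irreducible_rep_iff:
  assumes "representation \<rho>"
  shows "irreducible_rep \<rho> \<longleftrightarrow>
    (\<forall>W. vec.subspace W \<and> (\<forall>w\<in>W. \<rho> S_mat *v w \<in> W) \<and> (\<forall>w\<in>W. \<rho> T_mat *v w \<in> W)
      \<longrightarrow> W = {0} \<or> W = UNIV)"
proof -
  have "(\<forall>g\<in>carrier SL2Z. \<forall>w\<in>W. \<rho> g *v w \<in> W) \<longleftrightarrow>
      (\<forall>w\<in>W. \<rho> S_mat *v w \<in> W) \<and> (\<forall>w\<in>W. \<rho> T_mat *v w \<in> W)" (is "?l \<longleftrightarrow> ?r") for W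
  proof
    assume r: ?r
    have "\<forall>w\<in>W. \<rho> g *v w \<in> W" if "g \<in> carrier SL2Z" for g
      using that
    proof (induction g rule: SL2Z_induct)
      case (mult g h)
      then show ?case
        by (simp add: representation_mult [OF assms] flip: matrix_vector_mul_assoc)
    qed (use r in auto)
    then show ?l by blast
  qed auto
  then show ?thesis by (simp add: irreducible_rep_def)
qed

lemma invertible_mat2:
  fixes a b c d :: complex
  shows "invertible (mat2 a b c d) \<longleftrightarrow> a * d - b * c \<noteq> 0"
  by (simp add: invertible_det_nz)

subsection \<open>Isomorphic representations\<close>

text \<open>Change of basis. The inverse \<open>P'\<close> is a separate variable so that concrete
  pairs of matrices can be supplied.\<close>

lemma conjugate_rep:
  assumes "representation \<rho>" and inv: "P ** P' = mat 1" "P' ** P = mat 1"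
  shows "representation (\<lambda>g. P ** \<rho> g ** P')"
    and "iso_rep \<rho> (\<lambda>g. P ** \<rho> g ** P')"
proof -
  have mid: "P ** (X ** Y) ** P' = P ** X ** P' ** (P ** Y ** P')" for X Y
  proof -
    have "P ** X ** P' ** (P ** Y ** P') = P ** X ** (P' ** P) ** Y ** P'"
      by (simp only: matrix_mul_assoc)
    then show ?thesis by (simp add: inv matrix_mul_assoc)
  qed
  have P: "invertible P" "invertible P'" using inv by (auto simp: invertible_def)
  then show "representation (\<lambda>g. P ** \<rho> g ** P')"
    using representation_mult [OF assms(1)] representation_invertible [OF assms(1)]
    unfolding representation_def hom_def
    by (auto simp: SL2Z_def GL_complex_def invertible_mult mid)
  show "iso_rep \<rho> (\<lambda>g. P ** \<rho> g ** P')"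
    unfolding iso_rep_def using P inv
    by (intro exI [of _ P]) (simp flip: matrix_mul_assoc)
qed

lemma iso_rep_sym:
  assumes "iso_rep \<rho> \<sigma>" shows "iso_rep \<sigma> \<rho>"
proof -
  obtain P where P: "invertible P" "\<And>g. g \<in> carrier SL2Z \<Longrightarrow> P ** \<rho> g = \<sigma> g ** P"
    using assms by (auto simp: iso_rep_def)
  obtain P' where P': "P ** P' = mat 1" "P' ** P = mat 1"
    using P(1) by (auto simp: invertible_def)
  have "P' ** \<sigma> g = \<rho> g ** P'" if "g \<in> carrier SL2Z" for g
  proof -
    have "P' ** \<sigma> g = P' ** (\<sigma> g ** P) ** P'"
      by (simp add: P' flip: matrix_mul_assoc)
    also have "\<dots> = (P' ** P) ** \<rho> g ** P'"
      by (simp only: P(2) [OF that, symmetric] matrix_mul_assoc)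
    finally show ?thesis by (simp add: P')
  qed
  moreover have "invertible P'" using P' by (auto simp: invertible_def)
  ultimately show ?thesis by (auto simp: iso_rep_def)
qed

lemma iso_rep_trans:
  assumes "iso_rep \<rho> \<sigma>" "iso_rep \<sigma> \<tau>" shows "iso_rep \<rho> \<tau>"
proof -
  obtain P Q where P: "invertible P" "\<And>g. g \<in> carrier SL2Z \<Longrightarrow> P ** \<rho> g = \<sigma> g ** P"
    and Q: "invertible Q" "\<And>g. g \<in> carrier SL2Z \<Longrightarrow> Q ** \<sigma> g = \<tau> g ** Q"
    using assms by (auto simp: iso_rep_def)
  have "Q ** P ** \<rho> g = \<tau> g ** (Q ** P)" if "g \<in> carrier SL2Z" for g
    using P(2) [OF that] Q(2) [OF that] by (metis matrix_mul_assoc)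
  then show ?thesis
    using P(1) Q(1) by (auto simp: iso_rep_def intro!: exI [of _ "Q ** P"] invertible_mult)
qed

lemma irreducible_rep_iso:
  assumes "iso_rep \<rho> \<sigma>" "irreducible_rep \<sigma>"
  shows "irreducible_rep \<rho>"
  unfolding irreducible_rep_def
proof (intro allI impI)
  fix W assume W: "vec.subspace W \<and> (\<forall>g\<in>carrier SL2Z. \<forall>w\<in>W. \<rho> g *v w \<in> W)"
  obtain P where P: "invertible P" "\<And>g. g \<in> carrier SL2Z \<Longrightarrow> P ** \<rho> g = \<sigma> g ** P"
    using assms by (auto simp: iso_rep_def)
  obtain P' where P': "P ** P' = mat 1" "P' ** P = mat 1"
    using P(1) by (auto simp: invertible_def)
  have cancel: "P' *v (P *v w) = w" "P *v (P' *v w) = w" for w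
    by (simp_all add: matrix_vector_mul_assoc P')
  let ?V = "(\<lambda>w. P *v w) ` W"
  have "vec.subspace ?V"
    using W by (intro vec.subspace_image) auto
  moreover have "\<sigma> g *v v \<in> ?V" if "g \<in> carrier SL2Z" "v \<in> ?V" for g v
  proof -
    from that(2) obtain w where w: "w \<in> W" "v = P *v w" by blast
    have "\<sigma> g *v v = P *v (\<rho> g *v w)"
      using P(2) [OF that(1)] by (simp add: w matrix_vector_mul_assoc)
    then show ?thesis using W w that by blast
  qed
  ultimately have "?V = {0} \<or> ?V = UNIV"
    using assms(2) unfolding irreducible_rep_def by blast
  moreover have "W = (\<lambda>w. P' *v w) ` ?V" by (simp add: image_image cancel)
  ultimately show "W = {0} \<or> W = UNIV"
    using cancel by (metis image_insert image_empty matrix_vector_mult_0_right surj_def)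
qed

lemma Sym3_mat_invertible: "invertible P \<Longrightarrow> invertible (Sym3_mat P)"
  unfolding invertible_def by (metis Sym3_mat_mult Sym3_mat_one)

lemma iso_rep_Sym3: "iso_rep \<rho> \<sigma> \<Longrightarrow> iso_rep (Sym3 \<rho>) (Sym3 \<sigma>)"
  unfolding iso_rep_def Sym3_def by (metis Sym3_mat_mult Sym3_mat_invertible)

section \<open>Similarity invariance of the characteristic polynomial\<close>

lemma map_matrix_const_poly_mult:
  fixes P Q :: "complex^'n^'n"
  shows "map_matrix (\<lambda>a. [:a:]) (P ** Q) = map_matrix (\<lambda>a. [:a:]) P ** map_matrix (\<lambda>a. [:a:]) Q"
proof -
  have "[:sum f A:] = (\<Sum>x\<in>A. [:f x:])" for f :: "'n \<Rightarrow> complex" and A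
  proof (induction A rule: infinite_finite_induct)
    case (insert x F)
    then show ?case by (simp flip: insert.IH)
  qed simp_all
  then show ?thesis
    by (simp add: vec_eq_iff map_matrix_def matrix_matrix_mult_def mult.commute)
qed

lemma mat_mult_commute:
  fixes A :: "'a::comm_ring_1^'n^'n"
  shows "mat k ** A = A ** mat k"
  by (simp add: vec_eq_iff matrix_matrix_mult_def mat_def if_distrib [of "\<lambda>x. x * _"] 
    if_distrib [of "\<lambda>x. _ * x"] mult.commute cong: if_cong)

lemma matrix_diff_distrib:
  fixes A B C :: "'a::comm_ring_1^'n^'n"
  shows "A ** (B - C) = A ** B - A ** C" "(B - C) ** A = B ** A - C ** A"
  by (simp_all add: vec_eq_iff matrix_matrix_mult_def algebra_simps sum_subtractf)

text \<open>Viewed as a constant polynomial matrix, \<open>P\<close> still intertwines the two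
  characteristic matrices. Its determinant has an inverse, so it is nonzero and cancels.\<close>

lemma charpoly_similar:
  fixes P A B :: "complex^'n^'n"
  assumes "invertible P" "P ** A = B ** P"
  shows "charpoly A = charpoly B"
proof -
  let ?c = "map_matrix (\<lambda>a. [:a:]) :: complex^'n^'n \<Rightarrow> complex poly^'n^'n"
  obtain P' where "P ** P' = mat 1" using assms by (auto simp: invertible_def)
  then have "?c P ** ?c P' = mat 1"
    by (simp add: vec_eq_iff mat_def flip: map_matrix_const_poly_mult)
  then have "det (?c P) * det (?c P') = 1" by (metis det_mul det_I)
  then have nz: "det (?c P) \<noteq> 0" by auto
  have "?c P ** (mat [:0, 1:] - ?c A) = (mat [:0, 1:] - ?c B) ** ?c P"
    using assms(2) by (simp add: mat_mult_commute matrix_diff_distrib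
      flip: map_matrix_const_poly_mult)
  then have "det (?c P) * charpoly A = charpoly B * det (?c P)"
    unfolding charpoly_def by (metis det_mul)
  then show ?thesis using nz by simp
qed

lemma T_regular_iso: "iso_rep \<rho> \<sigma> \<Longrightarrow> T_regular \<rho> \<longleftrightarrow> T_regular \<sigma>"
  unfolding iso_rep_def T_regular_def eigenvalues_def
  using charpoly_similar T_in_SL2Z by metis

subsection \<open>Regularity\<close>

lemma charpoly_diag:
  fixes d :: "'n::finite \<Rightarrow> complex"
  shows "charpoly (\<chi> i j. if i = j then d i else 0) = (\<Prod>i\<in>UNIV. [:- d i, 1:])"
  unfolding charpoly_def by (subst det_diagonal) (simp_all add: mat_def)

text \<open>The multiplicity of an eigenvalue \<open>l\<close> is the size of the fibre of
  \<open>d\<close> over \<open>l\<close>.\<close>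

lemma T_regular_diag_iff:
  fixes d :: "'n::finite \<Rightarrow> complex"
  assumes "\<rho> T_mat = (\<chi> i j. if i = j then d i else 0)"
  shows "T_regular \<rho> \<longleftrightarrow> inj d"
proof -
  have ev: "eigenvalues (\<rho> T_mat) = image_mset d (mset_set UNIV)"
    unfolding eigenvalues_def assms charpoly_diag
    by (subst proots_prod) (simp_all add: sum_unfold_sum_mset)
  have count: "count (eigenvalues (\<rho> T_mat)) l = card {i. d i = l}" for l
    by (simp add: ev count_image_mset' eq_commute flip: card_eq_sum)
  have "T_regular \<rho> \<longleftrightarrow> (\<forall>i. card {j. d j = d i} = 1)"
    unfolding T_regular_def count by (simp add: ev)
  also have "\<dots> \<longleftrightarrow> inj d"
  proof
    assume *: "\<forall>i. card {j. d j = d i} = 1"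
    show "inj d"
    proof (rule injI)
      fix i j assume "d i = d j"
      then have "{i, j} \<subseteq> {k. d k = d j}" by auto
      with * show "i = j" by (metis card_1_singletonE insert_subset singletonD)
    qed
  next
    assume "inj d"
    then have "{j. d j = d i} = {i}" for i by (auto dest: injD)
    then show "\<forall>i. card {j. d j = d i} = 1" by simp
  qed
  finally show ?thesis .
qed

lemma T_regular_triangular_iff:
  assumes "\<rho> T_mat = mat2 x \<beta> 0 y"
  shows "T_regular \<rho> \<longleftrightarrow> x \<noteq> y"
proof -
  have "charpoly (mat2 x \<beta> 0 y) = [:- x, 1:] * [:- y, 1:]"
    unfolding charpoly_def det_2 by (simp add: mat_def map_matrix_def)
  then have "eigenvalues (\<rho> T_mat) = {#x, y#}"
    by (simp add: eigenvalues_def assms proots_mult del: mult_pCons_left mult_pCons_right)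
  then show ?thesis by (auto simp: T_regular_def)
qed

lemma vector_4 [simp]:
  fixes w x y z :: "'a::zero"
  shows "vector [w, x, y, z] $ (1::4) = w" "vector [w, x, y, z] $ (2::4) = x"
    "vector [w, x, y, z] $ (3::4) = y" "vector [w, x, y, z] $ (4::4) = z"
  by (simp_all add: vector_def)

text \<open>Expansion of the cubic form with coefficients \<open>p, q, r, s\<close> under the
  substitution of \<open>a e\<^sub>1 + c e\<^sub>2\<close> for \<open>e\<^sub>1\<close> and
  \<open>b e\<^sub>1 + d e\<^sub>2\<close> for \<open>e\<^sub>2\<close>.\<close>

lemma Sym3_mat_mult_vec:
  "Sym3_mat (mat2 a b c d) *v vector [p, q, r, s] = vector
    [a^3 * p + a^2 * b * q + a * b^2 * r + b^3 * s,
     3 * a^2 * c * p + (a^2 * d + 2 * a * b * c) * q + (2 * a * b * d + b^2 * c) * r + 3 * b^2 * d * s,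
     3 * a * c^2 * p + (2 * a * c * d + b * c^2) * q + (a * d^2 + 2 * b * c * d) * r + 3 * b * d^2 * s,
     c^3 * p + c^2 * d * q + c * d^2 * r + d^3 * s]"
  by (simp add: vec_eq_iff forall_4 sum_4 matrix_vector_mult_def Sym3_mat_def
      linear_form_def column_def numeral_eq_Suc algebra_simps)

lemma vec4_eta: "(w :: 'a::zero^4) = vector [w $ 1, w $ 2, w $ 3, w $ 4]"
  by (simp add: vec_eq_iff forall_4)

lemma Sym3_mat_diag:
  "Sym3_mat (mat2 x 0 0 y) = (\<chi> i j. if i = j then x ^ (3 - sym3_deg i) * y ^ sym3_deg i else 0)"
  by (simp add: vec_eq_iff forall_4 Sym3_mat_def linear_form_def column_def numeral_eq_Suc)

text \<open>Divided by \<open>x^3\<close>, the weights are \<open>1, t, t^2, t^3\<close> with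
  \<open>t = y / x\<close> different from 1, so two of them agree only if \<open>t^2 = 1\<close> or
  \<open>t^3 = 1\<close>.\<close>

lemma inj_sym3_weights_iff:
  fixes x y :: complex
  assumes "x \<noteq> 0" "y \<noteq> 0" "x \<noteq> y"
  shows "inj (\<lambda>i. x ^ (3 - sym3_deg i) * y ^ sym3_deg i) \<longleftrightarrow> y \<noteq> - x \<and> x^2 + x * y + y^2 \<noteq> 0"
proof -
  have sq: "x^2 = y^2 \<longleftrightarrow> y = - x"
    using assms by (auto simp: power2_eq_iff)
  have "x^3 - y^3 = (x - y) * (x^2 + x * y + y^2)"
    by (simp add: algebra_simps power2_eq_square power3_eq_cube)
  then have cube: "x^3 = y^3 \<longleftrightarrow> x^2 + x * y + y^2 = 0"
    using assms by (metis eq_iff_diff_eq_0 mult_eq_0_iff)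
  \<comment> \<open>Injectivity unfolds to all ordered pairs of indices, hence both orientations of
    each equation.\<close>
  have [simp]: "x^3 = x^2 * y \<longleftrightarrow> False" "x^2 * y = x^3 \<longleftrightarrow> False"
      "x * y^2 = y^3 \<longleftrightarrow> False" "y^3 = x * y^2 \<longleftrightarrow> False"
      "x^2 * y = x * y^2 \<longleftrightarrow> False" "x * y^2 = x^2 * y \<longleftrightarrow> False"
      "x^3 = x * y^2 \<longleftrightarrow> x^2 = y^2" "x * y^2 = x^3 \<longleftrightarrow> x^2 = y^2"
      "x^2 * y = y^3 \<longleftrightarrow> x^2 = y^2" "y^3 = x^2 * y \<longleftrightarrow> x^2 = y^2"
      "y^3 = x^3 \<longleftrightarrow> x^3 = y^3"
    using assms by (auto simp: power2_eq_square power3_eq_cube)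
  show ?thesis
    by (auto simp: inj_def forall_4 sq cube)
qed

subsection \<open>Invariant subspaces of the symmetric cube\<close>

text \<open>For the diagonal operator \<open>D\<close> with entries \<open>d\<close>, the product of
  \<open>D - d j\<close> over all \<open>j\<close> other than \<open>i\<close> kills every
  coordinate except the one at \<open>i\<close>, which it multiplies by a nonzero number.\<close>

lemma diag_invariant_axis:
  fixes W :: "('a::field^'n) set" and d :: "'n \<Rightarrow> 'a"
  assumes W: "vec.subspace W" and d: "inj d"
    and inv: "\<And>w. w \<in> W \<Longrightarrow> (\<chi> i. d i * w $ i) \<in> W"
    and w: "w \<in> W" "w $ i \<noteq> 0"
  shows "axis i 1 \<in> W"
proof -
  have "(\<chi> k. (\<Prod>j\<in>J. d k - d j) * w $ k) \<in> W" if "finite J" for J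
    using that
  proof induction
    case empty
    then show ?case using w by simp
  next
    case (insert l J)
    let ?v = "\<chi> k. (\<Prod>j\<in>J. d k - d j) * w $ k"
    have "(\<chi> k. d k * ?v $ k) - d l *s ?v \<in> W"
      using insert.IH by (intro vec.subspace_diff vec.subspace_scale W inv)
    moreover have "(\<chi> k. d k * ?v $ k) - d l *s ?v = (\<chi> k. (\<Prod>j\<in>insert l J. d k - d j) * w $ k)"
      using insert.hyps by (simp add: vec_eq_iff algebra_simps)
    ultimately show ?case by simp
  qed
  from this [of "- {i}"] have "(\<chi> k. (\<Prod>j\<in>- {i}. d k - d j) * w $ k) \<in> W" by simp
  moreover define m where "m = (\<Prod>j\<in>- {i}. d i - d j) * w $ i"
  have "(\<chi> k. (\<Prod>j\<in>- {i}. d k - d j) * w $ k) = m *s axis i 1"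
    by (auto simp: vec_eq_iff m_def axis_def)
  ultimately have "inverse m *s (m *s axis i 1) \<in> W"
    using W by (metis vec.subspace_scale)
  moreover have "m \<noteq> 0" using w d by (auto simp: m_def dest: injD)
  ultimately show ?thesis by simp
qed

lemma subspace_axis_UNIV:
  fixes W :: "('a::field^'n) set"
  assumes "vec.subspace W" "\<And>i. axis i 1 \<in> W"
  shows "W = UNIV"
proof -
  have "(\<Sum>i\<in>UNIV. w $ i *s axis i 1) \<in> W" for w
    using assms by (intro vec.subspace_sum vec.subspace_scale)
  then show ?thesis unfolding basis_expansion by blast
qed

lemma sym3_invariant_subspace_regular:
  assumes W: "vec.subspace W"
    and S: "\<And>w. w \<in> W \<Longrightarrow> Sym3_mat (mat2 a b c d) *v w \<in> W"
    and T: "\<And>w. w \<in> W \<Longrightarrow> Sym3_mat (mat2 x 0 0 y) *v w \<in> W"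
    and inj: "inj (\<lambda>i. x ^ (3 - sym3_deg i) * y ^ sym3_deg i)"
    and nz: "a \<noteq> 0" "b \<noteq> 0" "c \<noteq> 0" and "W \<noteq> {0}"
  shows "W = UNIV"
proof -
  have axis: "axis i 1 \<in> W" if "w \<in> W" "w $ i \<noteq> 0" for w i
  proof (rule diag_invariant_axis [OF W inj _ that])
    fix w assume "w \<in> W"
    from T [OF this] show "(\<chi> i. x ^ (3 - sym3_deg i) * y ^ sym3_deg i * w $ i) \<in> W"
      by (simp add: Sym3_mat_diag matrix_vector_mult_def if_distrib [of "\<lambda>x. x * _"] cong: if_cong)
  qed
  obtain w where "w \<in> W" "w \<noteq> 0" using \<open>W \<noteq> {0}\<close> vec.subspace_0 [OF W] by blast
  then obtain i where "w $ i \<noteq> 0" by (auto simp: vec_eq_iff)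
  with axis \<open>w \<in> W\<close> have i: "axis i 1 \<in> W" by blast
  \<comment> \<open>The first row of the matrix is \<open>a^3, a^2 b, a b^2, b^3\<close>, without
    zeros.\<close>
  have "(Sym3_mat (mat2 a b c d) *v axis i 1) $ 1 \<noteq> 0"
    using exhaust_4 [of i] nz
    by (subst vec4_eta [of "axis i 1"], subst Sym3_mat_mult_vec) (auto simp: axis_def)
  with S [OF i] axis have 1: "axis 1 1 \<in> W" by blast
  \<comment> \<open>The first column is \<open>a^3, 3 a^2 c, 3 a c^2, c^3\<close>, again without
    zeros.\<close>
  have "(Sym3_mat (mat2 a b c d) *v axis 1 1) $ j \<noteq> 0" for j
    using exhaust_4 [of j] nz
    by (subst vec4_eta [of "axis 1 1"], subst Sym3_mat_mult_vec) (auto simp: axis_def)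
  with S [OF 1] axis have "axis j 1 \<in> W" for j by blast
  with W show ?thesis by (rule subspace_axis_UNIV)
qed

text \<open>With scalars removed, \<open>T\<close> minus the identity (fact \<open>N\<close>) lowers
  the degree in \<open>e\<^sub>2\<close>, with leading factors 3, 2, 1, and \<open>S\<close> (fact
  \<open>J\<close>) reverses the order of the monomials up to sign.\<close>

lemma sym3_invariant_subspace_unipotent:
  assumes W: "vec.subspace W"
    and S: "\<And>w. w \<in> W \<Longrightarrow> Sym3_mat (mat2 0 (- k) k 0) *v w \<in> W"
    and T: "\<And>w. w \<in> W \<Longrightarrow> Sym3_mat (mat2 x x 0 x) *v w \<in> W"
    and nz: "k \<noteq> 0" "x \<noteq> 0" and "W \<noteq> {0}"
  shows "W = UNIV"
proof -
  have scale: "vector [m * p, m * q, m * r, m * s] \<in> W"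
    if "vector [p, q, r, s] \<in> W" for m p q r s
  proof -
    have "m *s vector [p, q, r, s] = (vector [m * p, m * q, m * r, m * s] :: complex^4)"
      by (simp add: vec_eq_iff forall_4)
    then show ?thesis using vec.subspace_scale [OF W that] by metis
  qed
  have add: "vector [p + p', q + q', r + r', s + s'] \<in> W"
    if "vector [p, q, r, s] \<in> W" "vector [p', q', r', s'] \<in> W" for p q r s p' q' r' s'
  proof -
    have "vector [p, q, r, s] + vector [p', q', r', s'] = (vector [p + p', q + q', r + r', s + s'] :: complex^4)"
      by (simp add: vec_eq_iff forall_4)
    then show ?thesis using vec.subspace_add [OF W that] by metis
  qed
  have J: "vector [- s, r, - q, p] \<in> W" if "vector [p, q, r, s] \<in> W" for p q r s
    using scale [OF S [OF that, unfolded Sym3_mat_mult_vec], of "inverse (k^3)"] nz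
    by (simp add: field_simps power2_eq_square power3_eq_cube)
  have N: "vector [q + r + s, 2 * r + 3 * s, 3 * s, 0] \<in> W" if "vector [p, q, r, s] \<in> W" for p q r s
  proof -
    have "inverse (x^3) *s (Sym3_mat (mat2 x x 0 x) *v vector [p, q, r, s]) - vector [p, q, r, s] \<in> W"
      using that by (intro vec.subspace_diff vec.subspace_scale W T)
    moreover have "inverse (x^3) *s (Sym3_mat (mat2 x x 0 x) *v vector [p, q, r, s]) - vector [p, q, r, s]
        = vector [q + r + s, 2 * r + 3 * s, 3 * s, 0]"
      unfolding Sym3_mat_mult_vec using nz
      by (simp add: vec_eq_iff forall_4 field_simps power2_eq_square power3_eq_cube)
    ultimately show ?thesis by simp
  qed
  obtain w where "w \<in> W" "w \<noteq> 0" using \<open>W \<noteq> {0}\<close> vec.subspace_0 [OF W] by blast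
  then obtain p q r s where w: "vector [p, q, r, s] \<in> W" "\<not> (p = 0 \<and> q = 0 \<and> r = 0 \<and> s = 0)"
    by (metis vec4_eta zero_index vec_eq_iff forall_4)
  \<comment> \<open>If \<open>n\<close> is the degree in \<open>e\<^sub>2\<close>, then applying
    \<open>N\<close> exactly \<open>n\<close> times leaves \<open>n!\<close> times the leading
    coefficient at \<open>e\<^sub>1\<^sup>3\<close>; hence the witnesses \<open>6 * s\<close>,
    \<open>2 * r\<close> and \<open>q\<close>.\<close>
  have "\<exists>m. m \<noteq> 0 \<and> vector [m, 0, 0, 0] \<in> W"
  proof (cases "s = 0")
    case False
    then show ?thesis using N [OF N [OF N [OF w(1)]]] by (auto intro!: exI [of _ "6 * s"])
  next
    case s: True
    show ?thesis
    proof (cases "r = 0")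
      case False
      then show ?thesis using N [OF N [OF w(1)]] s by (auto intro!: exI [of _ "2 * r"])
    next
      case r: True
      show ?thesis
      proof (cases "q = 0")
        case False
        then show ?thesis using N [OF w(1)] s r by (auto intro!: exI [of _ q])
      next
        case True
        then show ?thesis using w s r by auto
      qed
    qed
  qed
  then obtain m where m: "m \<noteq> 0" "vector [m, 0, 0, 0] \<in> W" by blast
  have 1: "vector [1, 0, 0, 0] \<in> W" using scale [OF m(2), of "inverse m"] m(1) by simp
  have 4: "vector [0, 0, 0, 1] \<in> W" using J [OF 1] by simp
  have "vector [6, 6, 0, 0] \<in> W" using N [OF N [OF 4]] by simp
  from scale [OF add [OF this scale [OF 1, of "- 6"]], of "1 / 6"]
  have 2: "vector [0, 1, 0, 0] \<in> W" by simp
  have 3: "vector [0, 0, 1, 0] \<in> W" using scale [OF J [OF 2], of "- 1"] by simp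
  have "axis i 1 \<in> W" for i
    using exhaust_4 [of i] 1 2 3 4 by (subst vec4_eta) (auto simp: axis_def)
  with W show ?thesis by (rule subspace_axis_UNIV)
qed

text \<open>The line through \<open>v\<close> is invariant under both generators, and proper because
  the dimension exceeds 1.\<close>

lemma common_eigenvector_not_irreducible:
  fixes \<rho> :: "int^2^2 \<Rightarrow> complex^'n^'n"
  assumes "representation \<rho>" "CARD('n) > 1" "v \<noteq> 0"
    and S: "\<rho> S_mat *v v = k *s v" and T: "\<rho> T_mat *v v = l *s v"
  shows "\<not> irreducible_rep \<rho>"
proof
  assume "irreducible_rep \<rho>"
  moreover have "\<forall>w\<in>vec.span {v}. \<rho> S_mat *v w \<in> vec.span {v}"
      "\<forall>w\<in>vec.span {v}. \<rho> T_mat *v w \<in> vec.span {v}"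
    by (auto simp: vec.span_singleton vec.scale S T)
  ultimately have "vec.span {v} = {0} \<or> vec.span {v} = UNIV"
    using irreducible_rep_iff [OF assms(1)] vec.subspace_span by blast
  moreover have "vec.span {v} \<noteq> {0}" using \<open>v \<noteq> 0\<close> vec.span_base [of v "{v}"] by auto
  moreover have "vec.span {v} \<noteq> UNIV"
  proof
    assume "vec.span {v} = UNIV"
    then have "CARD('n) = vec.dim {v}" by (metis vec.dim_span vec_dim_card)
    also have "\<dots> \<le> 1" using vec.dim_le_card' [of "{v}"] by simp
    finally show False using assms(2) by simp
  qed
  ultimately show False by blast
qed

lemma sym3_prod_scale:
  "sym3_prod (k *s u) (l *s v) (m *s w) = (k * l * m) *s sym3_prod u v w"
  by (simp add: vec_eq_iff forall_4 sym3_prod_def linear_form_def numeral_eq_Suc algebra_simps)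

lemma irreducible_if_irreducible_Sym3:
  assumes \<alpha>: "representation \<alpha>" and "irreducible_rep (Sym3 \<alpha>)"
  shows "irreducible_rep \<alpha>"
proof (rule ccontr)
  assume "\<not> irreducible_rep \<alpha>"
  then obtain W where W: "vec.subspace W" "\<And>w. w \<in> W \<Longrightarrow> \<alpha> S_mat *v w \<in> W"
      "\<And>w. w \<in> W \<Longrightarrow> \<alpha> T_mat *v w \<in> W" "W \<noteq> {0}" "W \<noteq> UNIV"
    unfolding irreducible_rep_iff [OF \<alpha>] by blast
  then obtain v where v: "v \<in> W" "v \<noteq> 0" using vec.subspace_0 by blast
  have "W = vec.span {v}"
  proof -
    have "vec.dim W \<noteq> vec.dim (UNIV :: (complex^2) set)"
      using W vec.subspace_dim_equal [of W UNIV] by auto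
    then have "vec.dim W < 2"
      using vec.dim_subset [of W UNIV] by (simp add: vec_dim_card card_cart_basis)
    moreover have "vec.dim {v} = 1"
      using v by (simp add: vec.dim_eq_card_independent)
    ultimately show ?thesis
      using v W(1) vec.subspace_dim_equal [of "vec.span {v}" W]
      by (auto simp: vec.span_minimal)
  qed
  then obtain k l where S: "\<alpha> S_mat *v v = k *s v" and T: "\<alpha> T_mat *v v = l *s v"
    using W(2,3) [OF v(1)] by (auto simp: vec.span_singleton)
  \<comment> \<open>The outer coordinates of this cube are the cubes of the coordinates of
    \<open>v\<close>.\<close>
  have "sym3_prod v v v \<noteq> 0"
    using v(2) by (auto simp: vec_eq_iff forall_4 forall_2 sym3_prod_def linear_form_def numeral_eq_Suc)
  moreover have "Sym3 \<alpha> S_mat *v sym3_prod v v v = (k * k * k) *s sym3_prod v v v"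
      "Sym3 \<alpha> T_mat *v sym3_prod v v v = (l * l * l) *s sym3_prod v v v"
    by (simp_all add: Sym3_def Sym3_mat_prod S T sym3_prod_scale)
  ultimately have "\<not> irreducible_rep (Sym3 \<alpha>)"
    by (intro common_eigenvector_not_irreducible representation_Sym3 \<alpha>) auto
  with assms(2) show False by simp
qed

subsection \<open>Normal forms of two-by-two matrices\<close>

lemma quadratic_roots:
  fixes s p :: complex
  obtains x y where "x + y = s" "x * y = p"
proof
  let ?d = "csqrt (s^2 - 4 * p)"
  show "(s + ?d) / 2 + (s - ?d) / 2 = s" by (simp add: field_simps)
  have "(s + ?d) * (s - ?d) = s^2 - ?d^2" by (simp add: algebra_simps power2_eq_square)
  then show "(s + ?d) / 2 * ((s - ?d) / 2) = p" by simp
qed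

lemma triangularise:
  fixes A :: "complex^2^2"
  obtains P x \<beta> y where "invertible P" "P ** A = mat2 x \<beta> 0 y ** P"
proof -
  obtain a b c d where A: "A = mat2 a b c d" by (rule mat2_cases)
  show ?thesis
  proof (cases "c = 0")
    case True
    then show ?thesis using that [of "mat2 1 0 0 1" a b d] by (simp add: A invertible_mat2)
  next
    case False
    obtain x y where xy: "x + y = a + d" "x * y = a * d - b * c" by (rule quadratic_roots)
    have y: "y = a + d - x" using xy(1) by (simp add: algebra_simps)
    have "d * x - d * d - b * c = y * x - y * d" using xy(2) unfolding y by (simp add: algebra_simps)
    \<comment> \<open>The second row of the transforming matrix is a left eigenvector of
      \<open>A\<close> for \<open>y\<close>; it is the image of the first row under right
      multiplication by \<open>A - x\<close>.\<close>
    then have "mat2 0 (- 1) (- c) (x - d) ** A = mat2 x 1 0 y ** mat2 0 (- 1) (- c) (x - d)"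
      by (simp add: A y algebra_simps)
    then show ?thesis using False that [of "mat2 0 (- 1) (- c) (x - d)" x 1 y] by (simp add: invertible_mat2)
  qed
qed

text \<open>Jordan form, except that a nontrivial block has \<open>x\<close> instead of 1 above the
  diagonal: it is then \<open>x\<close> times the standard unipotent matrix, as needed for a
  twist.\<close>

lemma normal_form:
  fixes A :: "complex^2^2"
  assumes "invertible A"
  obtains P x \<beta> y where "invertible P" "P ** A = mat2 x \<beta> 0 y ** P"
    "x \<noteq> y \<and> \<beta> = 0 \<or> x = y \<and> (\<beta> = 0 \<or> \<beta> = x)"
proof -
  note result = that
  obtain P x \<beta> y where P: "invertible P" "P ** A = mat2 x \<beta> 0 y ** P" by (rule triangularise)
  have conj: thesis if "invertible Q" "Q ** mat2 x \<beta> 0 y = mat2 x \<beta>' 0 y ** Q"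
    "x \<noteq> y \<and> \<beta>' = 0 \<or> x = y \<and> (\<beta>' = 0 \<or> \<beta>' = x)" for Q \<beta>'
  proof (rule result [OF _ _ that(3)])
    show "invertible (Q ** P)" using P(1) that(1) by (simp add: invertible_mult)
    show "Q ** P ** A = mat2 x \<beta>' 0 y ** (Q ** P)"
      using P(2) that(2) by (metis matrix_mul_assoc)
  qed
  \<comment> \<open>A nonzero \<open>x\<close> is needed for the rescaling by
    \<open>x / \<beta>\<close> below to be invertible.\<close>
  have "det P * det A = x * y * det P" using P(2) by (metis det_mul det_mat2 mult_zero_right diff_zero)
  then have nz: "x \<noteq> 0" using P(1) assms by (auto simp: invertible_det_nz)
  show thesis
  proof (cases "x = y")
    case False
    then have "\<beta> + \<beta> / (x - y) * y = x * (\<beta> / (x - y))" by (simp add: field_simps)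
    then show thesis using False
      by (intro conj [of "mat2 1 (\<beta> / (x - y)) 0 1" 0]) (simp_all add: invertible_mat2)
  next
    case True
    show thesis
    proof (cases "\<beta> = 0")
      case True
      with \<open>x = y\<close> show thesis by (intro conj [of "mat2 1 0 0 1" 0]) (simp_all add: invertible_mat2)
    next
      case False
      with \<open>x = y\<close> nz show thesis
        by (intro conj [of "mat2 (x / \<beta>) 0 0 1" x]) (simp_all add: invertible_mat2)
    qed
  qed
qed

subsection \<open>Equal and distinct eigenvalues of \<open>T\<close>\<close>

text \<open>Otherwise \<open>e\<^sub>1\<close> would be a common eigenvector.\<close>

lemma lower_left_nonzero:
  assumes "representation \<alpha>" "irreducible_rep \<alpha>"
    and "\<alpha> S_mat = mat2 a b c d" "\<alpha> T_mat = mat2 x \<beta> 0 y"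
  shows "c \<noteq> 0"
proof
  assume "c = 0"
  have "\<not> irreducible_rep \<alpha>"
  proof (rule common_eigenvector_not_irreducible [OF assms(1)])
    show "\<alpha> S_mat *v vector [1, 0] = a *s vector [1, 0]"
      "\<alpha> T_mat *v vector [1, 0] = x *s vector [1, 0]"
      by (simp_all add: assms \<open>c = 0\<close> vec_eq_iff forall_2)
  qed (simp_all add: vec_eq_iff forall_2)
  with assms(2) show False by simp
qed

lemma diagonal_T_relations:
  assumes \<alpha>: "representation \<alpha>" "irreducible_rep \<alpha>"
    and T: "\<alpha> T_mat = mat2 x 0 0 y" and "x \<noteq> y"
  obtains a b c where "\<alpha> S_mat = mat2 a b c (- a)" "a \<noteq> 0" "b \<noteq> 0" "c \<noteq> 0"
    "a^2 * (x - y)^2 + x * y * (a^2 + b * c) = 0" "x \<noteq> 0" "y \<noteq> 0"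
proof -
  obtain a b c d where S: "\<alpha> S_mat = mat2 a b c d" by (rule mat2_cases)
  have xy: "x \<noteq> 0" "y \<noteq> 0"
    using representation_invertible [OF \<alpha>(1) T_in_SL2Z] by (auto simp: T invertible_mat2)
  have c: "c \<noteq> 0" using lower_left_nonzero [OF \<alpha> S T] .
  have b: "b \<noteq> 0"
  proof
    assume "b = 0"
    have "\<not> irreducible_rep \<alpha>"
    proof (rule common_eigenvector_not_irreducible [OF \<alpha>(1)])
      show "\<alpha> S_mat *v vector [0, 1] = d *s vector [0, 1]"
        "\<alpha> T_mat *v vector [0, 1] = y *s vector [0, 1]"
        by (simp_all add: S T \<open>b = 0\<close> vec_eq_iff forall_2)
    qed (simp_all add: vec_eq_iff forall_2)
    with \<alpha> show False by simp
  qed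
  \<comment> \<open>Upper right entry of the relation that \<open>S^2\<close> commutes with
    \<open>T\<close>; it forces \<open>S\<close> to have trace 0.\<close>
  have "(a * b + b * d) * y = x * (a * b + b * d)"
    using representation_rel(2) [OF \<alpha>(1)] by (simp add: S T)
  then have "b * (a + d) * (y - x) = 0" by (simp add: algebra_simps)
  then have d: "d = - a" using b \<open>x \<noteq> y\<close> by (simp add: add_eq_0_iff)
  \<comment> \<open>Lower left entry of \<open>(S T)^3 = S^2\<close>. On the left it is
    \<open>c x\<close> times the squared trace of \<open>S T\<close> minus its determinant; on the
    right it is 0, since \<open>S^2\<close> is scalar.\<close>
  have "c * x * (a^2 * (x - y)^2 + x * y * (a^2 + b * c)) = 0"
    using representation_rel(1) [OF \<alpha>(1), unfolded S T d mat2_mult mat2_eq_iff,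
      THEN conjunct2, THEN conjunct2, THEN conjunct1]
    by algebra
  then have rel: "a^2 * (x - y)^2 + x * y * (a^2 + b * c) = 0" using c xy by simp
  then have "a \<noteq> 0" using b c xy by auto
  with b c rel xy S d show thesis by (intro that) auto
qed

text \<open>When two weights collide, \<open>rel\<close> fixes \<open>b c / a^2\<close> as 3 (for
  \<open>y = - x\<close>) or 2 (for a primitive cube root of unity), which makes an explicit
  invariant subspace possible.\<close>

lemma irreducible_Sym3_iff_diagonal:
  assumes \<alpha>: "representation \<alpha>" "irreducible_rep \<alpha>"
    and T: "\<alpha> T_mat = mat2 x 0 0 y" and "x \<noteq> y"
  shows "irreducible_rep (Sym3 \<alpha>) \<longleftrightarrow> T_regular (Sym3 \<alpha>)"
proof -
  obtain a b c where S: "\<alpha> S_mat = mat2 a b c (- a)" and nz: "a \<noteq> 0" "b \<noteq> 0" "c \<noteq> 0"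
    and rel: "a^2 * (x - y)^2 + x * y * (a^2 + b * c) = 0" and xy: "x \<noteq> 0" "y \<noteq> 0"
    by (rule diagonal_T_relations [OF assms])
  note rep3 = representation_Sym3 [OF \<alpha>(1)]
  have reg: "T_regular (Sym3 \<alpha>) \<longleftrightarrow> inj (\<lambda>i. x ^ (3 - sym3_deg i) * y ^ sym3_deg i)"
    by (rule T_regular_diag_iff) (simp add: Sym3_def T Sym3_mat_diag)
  show ?thesis
  proof
    assume "T_regular (Sym3 \<alpha>)"
    then show "irreducible_rep (Sym3 \<alpha>)"
      unfolding irreducible_rep_iff [OF rep3] reg
      using sym3_invariant_subspace_regular [of _ a b c "- a" x y] nz
      by (auto simp: Sym3_def S T)
  next
    assume irr: "irreducible_rep (Sym3 \<alpha>)"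
    show "T_regular (Sym3 \<alpha>)"
    proof (rule ccontr)
      assume "\<not> T_regular (Sym3 \<alpha>)"
      then consider "y = - x" | "x^2 + x * y + y^2 = 0"
        using inj_sym3_weights_iff [OF xy \<open>x \<noteq> y\<close>] by (auto simp: reg)
      then show False
      proof cases
        case 1
        then have "x^2 * (3 * a^2 - b * c) = 0"
          using rel by (simp add: algebra_simps power2_eq_square)
        then have b: "b = 3 * a^2 / c" using nz xy by (simp add: field_simps)
        have "\<not> irreducible_rep (Sym3 \<alpha>)"
        \<comment> \<open>The eigenvector is the product of the linear forms in the orbit
          \<open>e\<^sub>1, a e\<^sub>1 \<plusminus> c e\<^sub>2\<close>, which \<open>S\<close> and \<open>T\<close> permute up to scalars.\<close>
        proof (rule common_eigenvector_not_irreducible [OF rep3])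
          show "Sym3 \<alpha> S_mat *v vector [a^2, 0, - (c^2), 0] = (- 8 * a^3) *s vector [a^2, 0, - (c^2), 0]"
            unfolding Sym3_def S Sym3_mat_mult_vec using nz
            by (simp add: vec_eq_iff forall_4 b field_simps power2_eq_square power3_eq_cube)
          show "Sym3 \<alpha> T_mat *v vector [a^2, 0, - (c^2), 0] = (x^3) *s vector [a^2, 0, - (c^2), 0]"
            unfolding Sym3_def T Sym3_mat_mult_vec
            by (simp add: vec_eq_iff forall_4 1 field_simps power2_eq_square power3_eq_cube)
          show "vector [a^2, 0, - (c^2), 0] \<noteq> (0 :: complex^4)"
            using nz by (simp add: vec_eq_iff forall_4)
        qed simp
        with irr show False by simp
      next
        case 2
        then have sq: "(x - y)^2 = - 3 * (x * y)"
          by algebra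
        have "x * y * (b * c - 2 * a^2) = 0"
          using rel unfolding sq by (simp add: algebra_simps)
        then have b: "b = 2 * a^2 / c" using nz xy by (simp add: field_simps)
        have "(x - y) * (x^2 + x * y + y^2) = x^3 - y^3"
          by (simp add: algebra_simps power2_eq_square power3_eq_cube)
        then have cube: "y^3 = x^3" using 2 by simp
        \<comment> \<open>\<open>W\<close> is spanned by \<open>e\<^sub>1\<^sup>2 e\<^sub>2\<close> and a combination of \<open>e\<^sub>1\<^sup>3\<close> and \<open>e\<^sub>2\<^sup>3\<close>, which share
          a \<open>T\<close>-eigenvalue; the combination is read off from \<open>S (e\<^sub>1\<^sup>2 e\<^sub>2)\<close>, whose
          \<open>e\<^sub>1 e\<^sub>2\<^sup>2\<close>-coefficient vanishes because \<open>b c = 2 a\<^sup>2\<close>.\<close>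
        define W :: "(complex^4) set"
          where "W = {w. w $ 3 = 0 \<and> a * b * w $ 4 + c^2 * w $ 1 = 0}"
        have W: "w \<in> W \<longleftrightarrow> (\<exists>q s. w = vector [- (a * b / c^2) * s, q, 0, s])" for w
          using nz by (auto simp: W_def vec_eq_iff forall_4 field_simps add_eq_0_iff)
        have "vec.subspace W"
          by (auto simp: vec.subspace_def W_def algebra_simps)
            (metis distrib_left mult_zero_right)+
        moreover have "Sym3 \<alpha> S_mat *v w \<in> W" if "w \<in> W" for w
        proof -
          from that W obtain q s where w: "w = vector [- (a * b / c^2) * s, q, 0, s]" by blast
          show ?thesis unfolding w Sym3_def S Sym3_mat_mult_vec using nz
            by (simp add: W_def b field_simps power2_eq_square power3_eq_cube)
        qed
        moreover have "Sym3 \<alpha> T_mat *v w \<in> W" if "w \<in> W" for w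
        proof -
          from that W obtain q s where w: "w = vector [- (a * b / c^2) * s, q, 0, s]" by blast
          show ?thesis unfolding w Sym3_def T Sym3_mat_mult_vec using nz
            by (simp add: W_def cube field_simps)
        qed
        ultimately have "W = {0} \<or> W = UNIV"
          using irr unfolding irreducible_rep_iff [OF rep3] by blast
        moreover have "vector [0, 1, 0, 0] \<in> W" "vector [0, 0, 1, 0] \<notin> W"
          by (simp_all add: W_def)
        moreover have "vector [0, 1, 0, 0] \<noteq> (0 :: complex^4)"
          by (simp add: vec_eq_iff forall_4)
        ultimately show False by blast
      qed
    qed
  qed
qed

section \<open>Twists of the standard representation\<close>

lemma standard_rep_mat2 [simp]:
  "standard_rep (mat2 a b c d) = mat2 (of_int a) (of_int b) (of_int c) (of_int d)"
  by (simp add: standard_rep_def vec_eq_iff forall_2)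

lemma standard_rep_mult: "standard_rep (g ** h) = standard_rep g ** standard_rep h"
proof -
  obtain a b c d where g: "g = mat2 a b c d" by (rule mat2_cases)
  obtain a' b' c' d' where h: "h = mat2 a' b' c' d'" by (rule mat2_cases)
  show ?thesis by (simp add: g h)
qed

lemma twist_eq: "twist \<rho> \<psi> g = mat (\<psi> g) ** \<rho> g"
  by (simp add: twist_def vec_eq_iff matrix_matrix_mult_def mat_def
    if_distrib [of "\<lambda>x. x * _"] cong: if_cong)

text \<open>The first row of \<open>g\<close> is nonzero as the determinant is 1. This makes the
  scalar attached to each group element unique, hence multiplicative.\<close>

lemma mat_mult_standard_rep_cancel:
  assumes g: "g \<in> carrier SL2Z" and eq: "mat k ** standard_rep g = mat l ** standard_rep g"
  shows "k = l"
proof -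
  obtain a b c d where abcd: "g = mat2 a b c d" by (rule mat2_cases)
  then have "complex_of_int (a * d - b * c) = 1" using g by (simp add: SL2Z_def)
  then have det: "complex_of_int a * of_int d - of_int b * of_int c = 1" by simp
  have "k * of_int a = l * of_int a" "k * of_int b = l * of_int b"
    using eq by (simp_all add: abcd mat_eq_mat2)
  then have "k = l \<or> a = 0 \<and> b = 0" by auto
  with det show ?thesis by auto
qed

text \<open>Being a nonzero multiple of the standard matrix passes to products, so it spreads from
  the generators to the whole group; the multiples form the character.\<close>

lemma twist_of_standard_if_generators:
  assumes \<alpha>: "representation \<alpha>"
    and S: "\<alpha> S_mat = mat k ** standard_rep S_mat" "k \<noteq> 0"
    and T: "\<alpha> T_mat = mat l ** standard_rep T_mat" "l \<noteq> 0"
  shows "\<exists>\<psi>. character \<psi> \<and> iso_rep \<alpha> (twist standard_rep \<psi>)"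
proof -
  have mult: "mat m ** standard_rep g ** (mat n ** standard_rep h) = mat (m * n) ** standard_rep (g ** h)"
    for m n g h
  proof -
    have "mat m ** standard_rep g ** (mat n ** standard_rep h) =
        mat m ** (standard_rep g ** mat n) ** standard_rep h"
      by (simp only: matrix_mul_assoc)
    also have "\<dots> = (mat m ** mat n) ** standard_rep (g ** h)"
      by (simp only: mat_mult_commute [of n "standard_rep g", symmetric] matrix_mul_assoc standard_rep_mult)
    also have "mat m ** mat n = (mat (m * n) :: complex^2^2)"
      by (simp add: mat_eq_mat2)
    finally show ?thesis .
  qed
  have "\<exists>m. m \<noteq> 0 \<and> \<alpha> g = mat m ** standard_rep g" if "g \<in> carrier SL2Z" for g
    using that
  proof (induction g rule: SL2Z_induct)
    case (mult g h)
    then obtain m n where "m \<noteq> 0" "n \<noteq> 0"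
      "\<alpha> g = mat m ** standard_rep g" "\<alpha> h = mat n ** standard_rep h" by blast
    then have "m * n \<noteq> 0" "\<alpha> (g ** h) = mat (m * n) ** standard_rep (g ** h)"
      using \<open>g \<in> _\<close> \<open>h \<in> _\<close> by (simp_all add: representation_mult [OF \<alpha>] \<open>mat _ ** _ ** _ = _\<close>)
    then show ?case by blast
  qed (use S T in auto)
  then obtain \<psi> where \<psi>: "\<And>g. g \<in> carrier SL2Z \<Longrightarrow> \<psi> g \<noteq> 0"
      "\<And>g. g \<in> carrier SL2Z \<Longrightarrow> \<alpha> g = mat (\<psi> g) ** standard_rep g"
    by metis
  have "\<psi> (g ** h) = \<psi> g * \<psi> h" if "g \<in> carrier SL2Z" "h \<in> carrier SL2Z" for g h
  proof (rule mat_mult_standard_rep_cancel)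
    show gh: "g ** h \<in> carrier SL2Z" using that by (rule SL2Z_mult_closed)
    show "mat (\<psi> (g ** h)) ** standard_rep (g ** h) = mat (\<psi> g * \<psi> h) ** standard_rep (g ** h)"
      using \<psi>(2) [OF gh] \<psi>(2) [OF that(1)] \<psi>(2) [OF that(2)] representation_mult [OF \<alpha> that]
      by (metis mult)
  qed
  then have "character \<psi>"
    using \<psi>(1) by (simp add: character_def hom_def Pi_iff SL2Z_def mult_group_complex_def)
  moreover have "iso_rep \<alpha> (twist standard_rep \<psi>)"
    unfolding iso_rep_def
    by (rule exI [of _ "mat 1"]) (auto simp: \<psi>(2) twist_eq invertible_det_nz)
  ultimately show ?thesis by blast
qed

lemma iso_twist_of_standard:
  assumes \<alpha>: "representation \<alpha>" "irreducible_rep \<alpha>" and T: "\<alpha> T_mat = mat2 x x 0 x"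
  shows "\<exists>\<psi>. character \<psi> \<and> iso_rep \<alpha> (twist standard_rep \<psi>)"
proof -
  obtain a b c d where S: "\<alpha> S_mat = mat2 a b c d" by (rule mat2_cases)
  have c: "c \<noteq> 0" using lower_left_nonzero [OF \<alpha> S T] .
  \<comment> \<open>This shear commutes with the matrix of \<open>T_mat\<close> and clears the upper
    left entry of that of \<open>S_mat\<close>. The relations then leave \<open>c\<close> times the
    standard matrix.\<close>
  define P where "P = mat2 1 (- (a / c)) 0 1"
  define P' where "P' = mat2 1 (a / c) 0 1"
  define \<beta> where "\<beta> g = P ** \<alpha> g ** P'" for g
  have "P ** P' = mat 1" "P' ** P = mat 1" by (simp_all add: P_def P'_def mat_eq_mat2)
  from conjugate_rep [OF \<alpha>(1) this]
  have \<beta>: "representation \<beta>" and iso: "iso_rep \<alpha> \<beta>" by (simp_all add: \<beta>_def [abs_def])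
  obtain b' d' where S': "\<beta> S_mat = mat2 0 b' c d'"
    using c by (simp add: \<beta>_def P_def P'_def S)
  have T': "\<beta> T_mat = mat2 x x 0 x"
    by (simp add: \<beta>_def P_def P'_def T algebra_simps)
  have x: "x \<noteq> 0"
    using representation_invertible [OF \<alpha>(1) T_in_SL2Z] by (auto simp: T invertible_mat2)
  have d': "d' = 0"
    using representation_rel(2) [OF \<beta>] c x by (simp add: S' T' algebra_simps)
  have "c^2 * x^3 * (b' + c) = 0"
    using representation_rel(1) [OF \<beta>, unfolded S' T' d' mat2_mult mat2_eq_iff,
      THEN conjunct2, THEN conjunct2, THEN conjunct1]
    by algebra
  then have b': "b' = - c" using c x by (simp add: add_eq_0_iff2)
  have "\<exists>\<psi>. character \<psi> \<and> iso_rep \<beta> (twist standard_rep \<psi>)"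
    by (rule twist_of_standard_if_generators [OF \<beta>, of c x])
      (simp_all add: S' [unfolded S_mat_def] T' [unfolded T_mat_eq] S_mat_def T_mat_eq mat_eq_mat2 b' d' c x)
  then show ?thesis using iso iso_rep_trans by blast
qed

lemma irreducible_Sym3_twist_standard:
  assumes "character \<psi>"
  shows "irreducible_rep (Sym3 (twist standard_rep \<psi>))"
proof -
  have nz: "\<psi> S_mat \<noteq> 0" "\<psi> T_mat \<noteq> 0"
    using assms S_in_SL2Z T_in_SL2Z unfolding character_def hom_def mult_group_complex_def by auto
  have S: "Sym3 (twist standard_rep \<psi>) S_mat = Sym3_mat (mat2 0 (- \<psi> S_mat) (\<psi> S_mat) 0)"
    and T: "Sym3 (twist standard_rep \<psi>) T_mat = Sym3_mat (mat2 (\<psi> T_mat) (\<psi> T_mat) 0 (\<psi> T_mat))"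
    by (simp_all add: Sym3_def twist_eq mat_eq_mat2) (simp_all add: S_mat_def T_mat_eq)
  show ?thesis
    unfolding irreducible_rep_def
  proof (intro allI impI)
    fix W assume W: "vec.subspace W \<and>
      (\<forall>g\<in>carrier SL2Z. \<forall>w\<in>W. Sym3 (twist standard_rep \<psi>) g *v w \<in> W)"
    show "W = {0} \<or> W = UNIV"
      using sym3_invariant_subspace_unipotent [of W, OF _ _ _ nz] W S_in_SL2Z T_in_SL2Z S T by metis
  qed
qed

text \<open>Over the complex numbers \<open>\<alpha> S_mat\<close> has an eigenvector, and a scalar
  \<open>\<alpha> T_mat\<close> would share it.\<close>

lemma T_nonscalar:
  assumes \<alpha>: "representation \<alpha>" "irreducible_rep \<alpha>"
  shows "\<alpha> T_mat \<noteq> mat2 x 0 0 x"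
proof
  assume T: "\<alpha> T_mat = mat2 x 0 0 x"
  obtain P s \<beta> t where P: "invertible P" "P ** \<alpha> S_mat = mat2 s \<beta> 0 t ** P" by (rule triangularise)
  obtain P' where P': "P ** P' = mat 1" "P' ** P = mat 1" using P by (auto simp: invertible_def)
  define v where "v = P' *v vector [1, 0]"
  have "\<alpha> S_mat ** P' = P' ** mat2 s \<beta> 0 t"
    using P(2) P' by (metis matrix_mul_assoc matrix_mul_lid matrix_mul_rid)
  then have "\<alpha> S_mat *v v = P' *v (mat2 s \<beta> 0 t *v vector [1, 0])"
    by (simp add: v_def matrix_vector_mul_assoc del: mat2_mult_vec)
  also have "mat2 s \<beta> 0 t *v vector [1, 0] = s *s vector [1, 0]"
    by (simp add: vec_eq_iff forall_2)
  finally have "\<alpha> S_mat *v v = s *s v" by (simp add: v_def vec.scale)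
  moreover have "\<alpha> T_mat *v v = x *s v"
    by (simp add: T vec_eq_iff forall_2 matrix_vector_mult_def sum_2)
  moreover have "v \<noteq> 0"
  proof
    assume "v = 0"
    then have "P *v v = 0" by simp
    then have "vector [1, 0] = (0 :: complex^2)" by (simp add: v_def matrix_vector_mul_assoc P')
    then show False by (simp add: vec_eq_iff forall_2)
  qed
  ultimately show False
    using common_eigenvector_not_irreducible [OF \<alpha>(1)] \<alpha>(2) by simp
qed

theorem theorem28:
  fixes \<alpha> :: "int^2^2 \<Rightarrow> complex^2^2"
  assumes "representation \<alpha>"
  shows "irreducible_rep (Sym3 \<alpha>) \<longleftrightarrow>
    irreducible_rep \<alpha> \<and>
      ((\<exists>\<psi>. character \<psi> \<and> iso_rep \<alpha> (twist standard_rep \<psi>)) \<or>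
       (T_regular \<alpha> \<and> T_regular (Sym3 \<alpha>)))"
proof (cases "irreducible_rep \<alpha>")
  case False
  then show ?thesis using irreducible_if_irreducible_Sym3 [OF assms] by blast
next
  case irr: True
  \<comment> \<open>Settles the twist alternative independently of the eigenvalues of
    \<open>T\<close>, so both cases below can use it.\<close>
  have std: "irreducible_rep (Sym3 \<alpha>)" if "character \<psi>" "iso_rep \<alpha> (twist standard_rep \<psi>)" for \<psi>
    using irreducible_rep_iso iso_rep_Sym3 irreducible_Sym3_twist_standard that by blast
  obtain P x \<beta> y where P: "invertible P" "P ** \<alpha> T_mat = mat2 x \<beta> 0 y ** P"
    and xy: "x \<noteq> y \<and> \<beta> = 0 \<or> x = y \<and> (\<beta> = 0 \<or> \<beta> = x)"
    using normal_form representation_invertible [OF assms T_in_SL2Z] by metis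
  obtain P' where P': "P ** P' = mat 1" "P' ** P = mat 1" using P by (auto simp: invertible_def)
  define \<alpha>' where "\<alpha>' g = P ** \<alpha> g ** P'" for g
  have \<alpha>': "representation \<alpha>'" and iso: "iso_rep \<alpha> \<alpha>'"
    using conjugate_rep [OF assms P'] by (simp_all add: \<alpha>'_def [abs_def])
  have irr': "irreducible_rep \<alpha>'" using irreducible_rep_iso [OF iso_rep_sym [OF iso]] irr .
  have T: "\<alpha>' T_mat = mat2 x \<beta> 0 y" by (simp add: \<alpha>'_def P(2) P' flip: matrix_mul_assoc)
  have irr3: "irreducible_rep (Sym3 \<alpha>) \<longleftrightarrow> irreducible_rep (Sym3 \<alpha>')"
    using irreducible_rep_iso iso_rep_Sym3 iso iso_rep_sym by blast
  have reg: "T_regular \<alpha> \<longleftrightarrow> x \<noteq> y"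
    using T_regular_iso [OF iso] T_regular_triangular_iff [of \<alpha>', OF T] by simp
  show ?thesis
  proof (cases "x = y")
    case False
    then have "irreducible_rep (Sym3 \<alpha>) \<longleftrightarrow> T_regular (Sym3 \<alpha>)"
      using irreducible_Sym3_iff_diagonal [OF \<alpha>' irr'] T xy irr3
        T_regular_iso [OF iso_rep_Sym3 [OF iso]] by simp
    then show ?thesis using std irr reg False by blast
  next
    case True
    \<comment> \<open>Excluding the scalar form leaves the Jordan block, so both sides of the
      equivalence are true here.\<close>
    then have "\<alpha>' T_mat = mat2 x x 0 x"
      using T xy T_nonscalar [OF \<alpha>' irr'] by auto
    then obtain \<psi> where "character \<psi>" "iso_rep \<alpha> (twist standard_rep \<psi>)"
      using iso_twist_of_standard [OF \<alpha>' irr'] iso_rep_trans [OF iso] by blast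
    then show ?thesis using std irr by blast
  qed
qed

end
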